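(* Let $n\ge1$. The number of odd descents of a permutation (i.e. the number of descents at odd positions) is $\frac12\lfloor\frac n2\rfloor$-mesic for permutations in $S_n$ with pair swapping; that is, its average over every orbit of the map $ps$ on $S_n$ is $\frac12\lfloor\frac n2\rfloor$.
   Context: $S_n$ is the set of permutations of $\{1,\dots,n\}$, in one-line notation $\pi=\pi(1)\pi(2)\cdots\pi(n)$. The pair swapping map $ps:S_n\to S_n$ is $ps(\pi)=\pi(2)\pi(1)\pi(4)\pi(3)\cdots\pi(n)\pi(n-1)$ if $n$ is even, and $ps(\pi)=\pi(2)\pi(1)\pi(4)\pi(3)\cdots\pi(n-1)\pi(n-2)\pi(n)$ if $n$ is odd. A descent of $\pi$ is a position $i\in\{1,\dots,n-1\}$ with $\pi(i)>\pi(i+1)$ (there is neither an ascent nor a descent at position $n$). A statistic $st$ is $c$-mesic for a bijection if $\frac{1}{\#\mathcal{O}}\sum_{x\in\mathcal{O}}st(x)=c$ for every orbit $\mathcal{O}$ of the bijection. *)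

theory Defs
  imports Complex_Main "HOL-Combinatorics.Permutations" "HOL-Combinatorics.Orbits"
begin

text \<open>
  Permutations of \<open>{1..n}\<close> are functions \<open>\<pi> :: nat \<Rightarrow> nat\<close> with \<open>\<pi> permutes {1..n}\<close>,
  so \<open>\<pi> i\<close> is the \<open>i\<close>-th letter of the one-line notation and \<open>\<pi>\<close> is the identity outside \<open>{1..n}\<close>.
\<close>

definition Sn :: "nat \<Rightarrow> (nat \<Rightarrow> nat) set" where
  "Sn n = {\<pi>. \<pi> permutes {1..n}}"

text \<open>
  Swap the letters at positions 1 and 2, 3 and 4, and so on; for odd \<open>n\<close> the last position
  is odd without a partner and is left alone.
\<close>

definition ps :: "nat \<Rightarrow> (nat \<Rightarrow> nat) \<Rightarrow> (nat \<Rightarrow> nat)" where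
  "ps n \<pi> = (\<lambda>i. if odd i \<and> i + 1 \<le> n then \<pi> (i + 1)
                 else if even i \<and> 1 \<le> i \<and> i \<le> n then \<pi> (i - 1)
                 else \<pi> i)"

definition descents :: "nat \<Rightarrow> (nat \<Rightarrow> nat) \<Rightarrow> nat set" where
  "descents n \<pi> = {i. 1 \<le> i \<and> i \<le> n - 1 \<and> \<pi> i > \<pi> (i + 1)}"

definition num_odd_descents :: "nat \<Rightarrow> (nat \<Rightarrow> nat) \<Rightarrow> nat" where
  "num_odd_descents n \<pi> = card {i \<in> descents n \<pi>. odd i}"

text \<open>
  \<open>f\<close> is a bijection of the finite set \<open>S\<close>. The library's \<^const>\<open>orbit\<close> collects the iterates
  \<open>f x, f (f x), \<dots>\<close>; as \<open>S\<close> is finite, this is the whole (two-sided) orbit of \<open>x\<close>.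
\<close>

definition mesic :: "'a set \<Rightarrow> ('a \<Rightarrow> 'a) \<Rightarrow> ('a \<Rightarrow> real) \<Rightarrow> real \<Rightarrow> bool" where
  "mesic S f st c \<longleftrightarrow> finite S \<and> bij_betw f S S \<and>
     (\<forall>\<O> \<in> orbit f ` S. (1 / real (card \<O>)) * (\<Sum>x\<in>\<O>. st x) = c)"

end

theory Submission
  imports Defs
begin

text \<open>
  Pair swapping is an involution, so an orbit is \<open>{\<pi>, ps n \<pi>}\<close>. There are \<open>\<lfloor>n/2\<rfloor>\<close> swapped pairs of
  positions \<open>(i, i + 1)\<close>, one for each odd \<open>i < n\<close>. Swapping the two (distinct) letters of a pair
  turns a descent at \<open>i\<close> into an ascent and vice versa, so each odd \<open>i < n\<close> is a descent of exactly
  one of \<open>\<pi>\<close> and \<open>ps n \<pi>\<close>. Hence the statistic sums to \<open>\<lfloor>n/2\<rfloor>\<close> over \<open>\<pi>\<close> and \<open>ps n \<pi>\<close>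
  (\<open>num_odd_descents_add_ps\<close>), and an involution with such constant sums is mesic
  (\<open>mesic_involution\<close>).
\<close>

lemma orbit_involution:
  assumes "f (f x) = x"
  shows "orbit f x = {x, f x}"
proof
  show "orbit f x \<subseteq> {x, f x}"
  proof
    fix y assume "y \<in> orbit f x"
    then show "y \<in> {x, f x}" by induction (use assms in auto)
  qed
  have "f x \<in> orbit f x" by (rule orbit.base)
  moreover from orbit.step[OF this] have "x \<in> orbit f x" by (simp add: assms)
  ultimately show "{x, f x} \<subseteq> orbit f x" by simp
qed

text \<open>
  An orbit of size two has average \<open>2 * c / 2\<close>. At a fixed point the orbit is a singleton, and the
  sum condition degenerates to \<open>2 * st x = 2 * c\<close>, so the average is again \<open>c\<close>.
\<close>

lemma mesic_involution:
  assumes "finite S"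
    and closed: "\<And>x. x \<in> S \<Longrightarrow> f x \<in> S"
    and invol: "\<And>x. x \<in> S \<Longrightarrow> f (f x) = x"
    and pair_sum: "\<And>x. x \<in> S \<Longrightarrow> st x + st (f x) = 2 * c"
  shows "mesic S f st c"
  unfolding mesic_def
proof (intro conjI ballI)
  show "finite S" by fact
  show "bij_betw f S S"
    using closed invol by (intro bij_betwI[where g = f]) auto
next
  fix A assume "A \<in> orbit f ` S"
  then obtain x where x: "x \<in> S" and "A = orbit f x" by blast
  then have A: "A = {x, f x}" by (simp add: orbit_involution invol)
  show "(1 / real (card A)) * (\<Sum>y\<in>A. st y) = c"
    using pair_sum[OF x] A by (cases "f x = x") auto
qed

lemma ps_ps: "ps n (ps n \<pi>) = \<pi>"
  by (rule ext) (auto simp: ps_def)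

lemma ps_permutes:
  assumes "\<pi> permutes {1..n}"
  shows "ps n \<pi> permutes {1..n}"
proof -
  \<comment> \<open>Swapping letters is precomposition with the swap of positions, which is \<open>ps n id\<close>.\<close>
  have comp: "ps n \<rho> = \<rho> \<circ> ps n id" for \<rho> :: "nat \<Rightarrow> nat"
    by (rule ext) (auto simp: ps_def)
  have "ps n id (ps n id i) = i" for i
    using comp[of "ps n id"] by (simp add: ps_ps fun_eq_iff)
  then have "bij_betw (ps n id) {1..n} {1..n}"
    by (intro bij_betwI[where g = "ps n id"]) (auto simp: ps_def elim!: oddE evenE)
  then have "ps n id permutes {1..n}"
    by (rule bij_imp_permutes) (auto simp: ps_def elim!: oddE)
  then show ?thesis
    unfolding comp[of \<pi>] by (rule permutes_compose) (rule assms)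
qed

lemma card_odd_less: "card {i. odd i \<and> i < n} = n div 2"
proof -
  have "{i. odd i \<and> i < n} = (\<lambda>k. 2 * k + 1) ` {..<n div 2}"
    by (auto elim!: oddE)
  then show ?thesis
    by (simp add: card_image inj_on_def)
qed

lemma num_odd_descents_add_ps:
  assumes "inj \<pi>"
  shows "num_odd_descents n \<pi> + num_odd_descents n (ps n \<pi>) = n div 2"
proof -
  let ?D = "{i \<in> descents n \<pi>. odd i}" and ?E = "{i \<in> descents n (ps n \<pi>). odd i}"
  have D: "?D = {i. odd i \<and> i < n \<and> \<pi> (i + 1) < \<pi> i}"
    by (auto simp: descents_def elim: oddE)
  have E: "?E = {i. odd i \<and> i < n \<and> \<pi> i < \<pi> (i + 1)}"
    by (auto simp: descents_def ps_def elim: oddE)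
  have "\<pi> i \<noteq> \<pi> (i + 1)" for i
    using injD[OF assms, of i "i + 1"] by auto
  then have "?D \<union> ?E = {i. odd i \<and> i < n}"
    unfolding D E using linorder_neq_iff by blast
  moreover have "?D \<inter> ?E = {}"
    unfolding D E by auto
  moreover have "finite ?D" "finite ?E"
    unfolding D E by simp_all
  ultimately show ?thesis
    unfolding num_odd_descents_def using card_Un_disjoint[of ?D ?E] card_odd_less[of n] by simp
qed

theorem theorem4p1:
  fixes n :: nat
  assumes "n \<ge> 1"
  shows "mesic (Sn n) (ps n) (\<lambda>\<pi>. real (num_odd_descents n \<pi>)) ((1 / 2) * real_of_int \<lfloor>real n / 2\<rfloor>)"
proof (rule mesic_involution)
  show "finite (Sn n)"
    by (simp add: Sn_def finite_permutations)
next
  fix \<pi> assume "\<pi> \<in> Sn n"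
  then have perm: "\<pi> permutes {1..n}" by (simp add: Sn_def)
  then show "ps n \<pi> \<in> Sn n" unfolding Sn_def by (simp only: mem_Collect_eq ps_permutes)
  show "ps n (ps n \<pi>) = \<pi>" by (rule ps_ps)
  have "\<lfloor>real n / 2\<rfloor> = int (n div 2)"
    using floor_divide_of_nat_eq[of n 2] by simp
  moreover have "real (num_odd_descents n \<pi>) + real (num_odd_descents n (ps n \<pi>)) = real (n div 2)"
    using num_odd_descents_add_ps[OF permutes_inj[OF perm], of n] by (metis of_nat_add)
  ultimately show "real (num_odd_descents n \<pi>) + real (num_odd_descents n (ps n \<pi>))
      = 2 * ((1 / 2) * real_of_int \<lfloor>real n / 2\<rfloor>)"
    by simp
qed

end
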